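(* Let $k\geq 2$ be an integer, $\epsilon\in(0,1)$, and $p$ a prime, and let $d=d(k)$ and $D=f_k^d(k)$ be the integers defined in the context. Then there are $n_3=n_3(k,\epsilon,p)$ and a constant $C\leq \max\{2d(4/\epsilon)^{2D},\,2d\cdot 4^{D^2}\}$ such that the following holds for all $n\geq n_3$. If $A\subseteq G:=\mathbb{F}_p^n$ is $k$-stable and $\Gamma_A$ is its Cayley graph, then there is a partition $\{V_1,\ldots,V_M\}$ of the vertex set $V(\Gamma_A)=G$ such that $M\leq C$, such that the $V_i$ are exactly the cosets of a subspace of $G$, and such that for all $1\leq i,j\leq M$ there is $t(i,j)\in\{0,1\}$ so that for all $z\in V_i$, $$|N^{t(i,j)}(z)\cap V_j|\geq (1-\epsilon)|V_j|.$$
   Context: Graphs here have a vertex set $V$ and a symmetric edge relation $E$; write $xy\in E$ when $x,y$ are related (in Cayley graphs $x=y$ is allowed). For a subset $A$ of an abelian group $G$, the Cayley graph $\Gamma_A=\Gamma(G,A)$ has vertex set $G$ and $xy$ is an edge iff $x+y\in A$. For $x\in V$ put $N^1(x):=\{y: xy\in E\}$ and $N^0(x):=V\setminus N^1(x)$; thus in $\Gamma_A$, $N^1(x)=A-x$ and $N^0(x)=(G\setminus A)-x$. A graph $(V,E)$ has the $k$-order property if there exist $a_1,\ldots,a_k,b_1,\ldots,b_k\in V$ such that $a_ib_j\in E$ iff $i\leq j$; otherwise it is $k$-stable. A set $A\subseteq G$ is $k$-stable if $\Gamma_A$ is $k$-stable, i.e. there are no $a_1,\ldots,a_k,b_1,\ldots,b_k\in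 G$ such that $a_i+b_j\in A$ iff $i\leq j$. Tree bound: write $2^m:=\{0,1\}^m$ and $2^{<m}:=\bigcup_{i=0}^{m-1}\{0,1\}^i$ (with $\{0,1\}^0$ consisting of the empty string). For strings, $\rho\trianglelefteq\eta$ means $\rho$ is an initial segment of $\eta$, $\rho\triangleleft\eta$ means $\rho\trianglelefteq\eta$ and $\rho\ne\eta$, and $\rho\wedge 1$ is $\rho$ with $1$ appended. The tree bound $d(\Gamma)$ of a graph $\Gamma=(V,E)$ is the least integer $m$ such that there do not exist sequences $\langle a_\eta:\eta\in 2^m\rangle$, $\langle b_\rho:\rho\in 2^{<m}\rangle$ of elements of $V$ such that for all $\eta\in 2^m$, $\rho\in 2^{<m}$ with $\rho\triangleleft\eta$, one has $a_\eta b_\rho\in E$ iff $\rho\wedge 1\trianglelefteq\eta$. The integer $d=d(k)$: it is a known theorem (Hodges) that for each $k$ there is an integer $d(k)<2^{k+2}-2$ such that every $k$-stable graph has tree bound at most $d(k)$; $d=d(k)$ denotes such an integer, fixed for each $k$. The integer $D$: let $h(x,y):=(x+y)2^{x+y}+1$ and $f_k(y):=h(k+1,y)$. Then $D:=f_k^d(k)$ is the result of applying $f_k$ to $k$ iteratively $d$ times. *)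

theory Defs
  imports
    Complex_Main
    "HOL-Library.FuncSet"
    "HOL-Library.Disjoint_Sets"
    "HOL-Library.Extended_Nat"
    "HOL-Library.Sublist"
    "HOL-Algebra.Module"
    "HOL-Number_Theory.Residues"
begin

definition is_graph :: "'a set \<Rightarrow> ('a \<times> 'a) set \<Rightarrow> bool" where
  "is_graph V E \<longleftrightarrow> E \<subseteq> V \<times> V \<and> sym E"

definition order_property :: "nat \<Rightarrow> 'a set \<Rightarrow> ('a \<times> 'a) set \<Rightarrow> bool" where
  "order_property k V E \<longleftrightarrow>
     (\<exists>a b. (\<forall>i\<in>{1..k}. a i \<in> V \<and> b i \<in> V) \<and>
            (\<forall>i\<in>{1..k}. \<forall>j\<in>{1..k}. (a i, b j) \<in> E \<longleftrightarrow> i \<le> j))"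

definition stable_graph :: "nat \<Rightarrow> 'a set \<Rightarrow> ('a \<times> 'a) set \<Rightarrow> bool" where
  "stable_graph k V E \<longleftrightarrow> \<not> order_property k V E"

definition nbhd :: "'a set \<Rightarrow> ('a \<times> 'a) set \<Rightarrow> nat \<Rightarrow> 'a \<Rightarrow> 'a set" where
  "nbhd V E t x = (if t = 1 then {y \<in> V. (x, y) \<in> E} else V - {y \<in> V. (x, y) \<in> E})"

text \<open>Binary strings are boolean lists, with \<^const>\<open>True\<close> for the digit 1.\<close>

definition has_tree :: "nat \<Rightarrow> 'a set \<Rightarrow> ('a \<times> 'a) set \<Rightarrow> bool" where
  "has_tree m V E \<longleftrightarrow>
     (\<exists>(a :: bool list \<Rightarrow> 'a) (b :: bool list \<Rightarrow> 'a).
        (\<forall>\<eta>. length \<eta> = m \<longrightarrow> a \<eta> \<in> V) \<and>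
        (\<forall>\<rho>. length \<rho> < m \<longrightarrow> b \<rho> \<in> V) \<and>
        (\<forall>\<eta> \<rho>. length \<eta> = m \<longrightarrow> length \<rho> < m \<longrightarrow> strict_prefix \<rho> \<eta> \<longrightarrow>
           ((a \<eta>, b \<rho>) \<in> E \<longleftrightarrow> prefix (\<rho> @ [True]) \<eta>)))"

text \<open>The infimum in \<^typ>\<open>enat\<close> is the least such \<open>m\<close>, and \<open>\<infinity>\<close> if there is none.\<close>

definition tree_bound :: "'a set \<Rightarrow> ('a \<times> 'a) set \<Rightarrow> enat" where
  "tree_bound V E = Inf {enat m | m. \<not> has_tree m V E}"

text \<open>
  The defining property of the integer \<open>d(k)\<close>. Only graphs with vertices in \<^typ>\<open>nat\<close> are
  mentioned, since a formula cannot quantify over types; the lemma \<open>tree_bound_le\<close> below shows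
  that the bound then holds for graphs over every type.
\<close>

definition is_tree_bound_for :: "nat \<Rightarrow> nat \<Rightarrow> bool" where
  "is_tree_bound_for k d \<longleftrightarrow>
     d < 2 ^ (k + 2) - 2 \<and>
     (\<forall>(V :: nat set) E. is_graph V E \<longrightarrow> stable_graph k V E \<longrightarrow> tree_bound V E \<le> enat d)"

definition h_fun :: "nat \<Rightarrow> nat \<Rightarrow> nat" where
  "h_fun x y = (x + y) * 2 ^ (x + y) + 1"

definition f_fun :: "nat \<Rightarrow> nat \<Rightarrow> nat" where
  "f_fun k y = h_fun (k + 1) y"

text \<open>
  The Cayley graph uses only the additive structure of \<open>G\<close>; the ring record is merely the carrier
  of additive notation in HOL-Algebra.
\<close>

definition cayley_edges :: "('a, 'm) ring_scheme \<Rightarrow> 'a set \<Rightarrow> ('a \<times> 'a) set" where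
  "cayley_edges G A = {(x, y). x \<in> carrier G \<and> y \<in> carrier G \<and> x \<oplus>\<^bsub>G\<^esub> y \<in> A}"

definition stable_set :: "nat \<Rightarrow> ('a, 'm) ring_scheme \<Rightarrow> 'a set \<Rightarrow> bool" where
  "stable_set k G A \<longleftrightarrow> stable_graph k (carrier G) (cayley_edges G A)"

text \<open>
  \<open>F\<^sub>p\<^sup>n\<close> as a module over \<open>residue_ring p\<close>; its submodules are the subspaces.
  The \<open>mult\<close> and \<open>one\<close> fields of the record play no role in a module.
\<close>

definition Fp_space :: "nat \<Rightarrow> nat \<Rightarrow> (int, nat \<Rightarrow> int) module" where
  "Fp_space p n =
     \<lparr>carrier = {..<n} \<rightarrow>\<^sub>E carrier (residue_ring (int p)),
      monoid.mult = undefined,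
      one = undefined,
      zero = (\<lambda>i\<in>{..<n}. \<zero>\<^bsub>residue_ring (int p)\<^esub>),
      add = (\<lambda>x y. \<lambda>i\<in>{..<n}. x i \<oplus>\<^bsub>residue_ring (int p)\<^esub> y i),
      smult = (\<lambda>c x. \<lambda>i\<in>{..<n}. c \<otimes>\<^bsub>residue_ring (int p)\<^esub> x i)\<rparr>"

lemma is_graph_cayley:
  assumes "abelian_group G"
  shows "is_graph (carrier G) (cayley_edges G A)"
proof -
  interpret abelian_group G by fact
  show ?thesis
    by (auto simp: is_graph_def cayley_edges_def sym_def a_comm)
qed

lemma module_Fp_space:
  assumes "prime p"
  shows "module (residue_ring (int p)) (Fp_space p n)"
proof -
  have p: "int p > 1"
    using prime_gt_1_nat[OF assms] by simp
  define R where "R = residue_ring (int p)"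
  interpret R: residues "int p" R
    by unfold_locales (use p in \<open>auto simp: R_def\<close>)
  have m: "module R (Fp_space p n)"
  proof (rule module.intro)
    show "cring R" by (rule R.cring)
    show "abelian_group (Fp_space p n)"
    proof (rule abelian_groupI)
      fix x assume x: "x \<in> carrier (Fp_space p n)"
      show "\<exists>y\<in>carrier (Fp_space p n). y \<oplus>\<^bsub>Fp_space p n\<^esub> x = \<zero>\<^bsub>Fp_space p n\<^esub>"
        using x by (intro bexI[of _ "\<lambda>i\<in>{..<n}. \<ominus>\<^bsub>R\<^esub> x i"])
          (auto simp: Fp_space_def R_def[symmetric] PiE_iff R.l_neg intro!: restrict_ext)
    qed (auto simp: Fp_space_def R_def[symmetric] PiE_iff R.add.m_ac fun_eq_iff extensional_def)
    show "module_axioms R (Fp_space p n)"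
      by unfold_locales
        (auto simp: Fp_space_def R_def[symmetric] PiE_iff fun_eq_iff extensional_def
          R.l_distr R.r_distr R.m_assoc)
  qed
  then show ?thesis by (simp add: R_def)
qed

lemma has_tree_antimono:
  assumes "has_tree d V E" "m \<le> d"
  shows "has_tree m V E"
proof -
  from assms(1) obtain a b :: "bool list \<Rightarrow> 'a" where
    a: "\<And>\<eta>. length \<eta> = d \<Longrightarrow> a \<eta> \<in> V" and
    b: "\<And>\<rho>. length \<rho> < d \<Longrightarrow> b \<rho> \<in> V" and
    ab: "\<And>\<eta> \<rho>. length \<eta> = d \<Longrightarrow> length \<rho> < d \<Longrightarrow> strict_prefix \<rho> \<eta> \<Longrightarrow>
           ((a \<eta>, b \<rho>) \<in> E \<longleftrightarrow> prefix (\<rho> @ [True]) \<eta>)"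
    unfolding has_tree_def by blast
  define pad where "pad \<eta> = \<eta> @ replicate (d - m) False" for \<eta> :: "bool list"
  have len: "length (pad \<eta>) = d" if "length \<eta> = m" for \<eta>
    using that assms(2) by (simp add: pad_def)
  have pre: "prefix (\<rho> @ [True]) (pad \<eta>) \<longleftrightarrow> prefix (\<rho> @ [True]) \<eta>"
    if "length \<eta> = m" "length \<rho> < m" for \<eta> \<rho>
    using that by (auto simp: pad_def prefix_def append_eq_append_conv2 append_eq_Cons_conv)
  have edge: "(a (pad \<eta>), b \<rho>) \<in> E \<longleftrightarrow> prefix (\<rho> @ [True]) \<eta>"
    if "length \<eta> = m" "length \<rho> < m" "strict_prefix \<rho> \<eta>" for \<eta> \<rho>
  proof -
    have "prefix \<rho> (pad \<eta>)"
      using that(3) by (auto simp: pad_def strict_prefix_def)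
    moreover have "\<rho> \<noteq> pad \<eta>"
      using len[OF that(1)] that(2) assms(2) by auto
    ultimately have "strict_prefix \<rho> (pad \<eta>)"
      by (simp add: strict_prefix_def)
    then show ?thesis
      using ab[of "pad \<eta>" \<rho>] len[OF that(1)] that(2) assms(2) pre[OF that(1,2)] by simp
  qed
  show ?thesis
    unfolding has_tree_def
    by (rule exI[of _ "a \<circ> pad"], rule exI[of _ b]) (use a b len edge assms(2) in auto)
qed

lemma tree_bound_le_iff: "tree_bound V E \<le> enat d \<longleftrightarrow> \<not> has_tree d V E"
proof
  assume "\<not> has_tree d V E"
  then show "tree_bound V E \<le> enat d"
    unfolding tree_bound_def by (intro Inf_lower) auto
next
  assume le: "tree_bound V E \<le> enat d"
  show "\<not> has_tree d V E"
  proof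
    assume t: "has_tree d V E"
    have "enat (Suc d) \<le> tree_bound V E"
      unfolding tree_bound_def
    proof (rule Inf_greatest, clarify)
      fix m assume "\<not> has_tree m V E"
      with has_tree_antimono[OF t] have "\<not> m \<le> d" by blast
      then show "enat (Suc d) \<le> enat m" by simp
    qed
    with le have "enat (Suc d) \<le> enat d" by (rule order_trans[rotated])
    then show False by simp
  qed
qed

lemma tree_bound_le:
  fixes V :: "'a set"
  assumes d: "is_tree_bound_for k d" and gr: "is_graph V E" and st: "stable_graph k V E"
  shows "tree_bound V E \<le> enat d"
  unfolding tree_bound_le_iff
proof
  assume "has_tree d V E"
  then obtain a b :: "bool list \<Rightarrow> 'a" where
    a: "\<And>\<eta>. length \<eta> = d \<Longrightarrow> a \<eta> \<in> V" and
    b: "\<And>\<rho>. length \<rho> < d \<Longrightarrow> b \<rho> \<in> V" and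
    ab: "\<And>\<eta> \<rho>. length \<eta> = d \<Longrightarrow> length \<rho> < d \<Longrightarrow> strict_prefix \<rho> \<eta> \<Longrightarrow>
           ((a \<eta>, b \<rho>) \<in> E \<longleftrightarrow> prefix (\<rho> @ [True]) \<eta>)"
    unfolding has_tree_def by blast
  define W where "W = a ` {\<eta>. length \<eta> = d} \<union> b ` {\<rho>. length \<rho> < d}"
  have fin: "finite {xs :: bool list. length xs \<le> d}"
    using finite_lists_length_le[of "UNIV :: bool set" d] by simp
  have "finite W"
    unfolding W_def by (intro finite_UnI finite_imageI finite_subset[OF _ fin]) auto
  then obtain g :: "'a \<Rightarrow> nat" where g: "inj_on g W"
    using finite_imp_inj_to_nat_seg by blast
  have WV: "W \<subseteq> V" using a b by (auto simp: W_def)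
  define E' where "E' = {(g x, g y) | x y. x \<in> W \<and> y \<in> W \<and> (x, y) \<in> E}"
  have E': "(g x, g y) \<in> E' \<longleftrightarrow> (x, y) \<in> E" if "x \<in> W" "y \<in> W" for x y
    using that g unfolding E'_def by (auto dest: inj_onD)
  have 1: "is_graph (g ` W) E'"
    using gr by (fastforce simp: is_graph_def E'_def sym_def)
  have 2: "stable_graph k (g ` W) E'"
    unfolding stable_graph_def
  proof
    assume "order_property k (g ` W) E'"
    then obtain u v where uv: "\<And>i. i \<in> {1..k} \<Longrightarrow> u i \<in> g ` W \<and> v i \<in> g ` W"
      and e: "\<And>i j. i \<in> {1..k} \<Longrightarrow> j \<in> {1..k} \<Longrightarrow> (u i, v j) \<in> E' \<longleftrightarrow> i \<le> j"
      unfolding order_property_def by blast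
    define r where "r = inv_into W g"
    have r: "r y \<in> W" "g (r y) = y" if "y \<in> g ` W" for y
      using that by (auto simp: r_def inv_into_into f_inv_into_f)
    have "(r (u i), r (v j)) \<in> E \<longleftrightarrow> i \<le> j" if "i \<in> {1..k}" "j \<in> {1..k}" for i j
      using E'[of "r (u i)" "r (v j)"] r uv[OF that(1)] uv[OF that(2)] e[OF that] by simp
    moreover have "r (u i) \<in> V \<and> r (v i) \<in> V" if "i \<in> {1..k}" for i
      using r uv[OF that] WV by blast
    ultimately have "order_property k V E"
      unfolding order_property_def
      by (intro exI[of _ "r \<circ> u"] exI[of _ "r \<circ> v"]) simp
    with st show False by (simp add: stable_graph_def)
  qed
  have mem: "a \<eta> \<in> W" if "length \<eta> = d" for \<eta>
    using that by (auto simp: W_def)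
  have mem': "b \<rho> \<in> W" if "length \<rho> < d" for \<rho>
    using that by (auto simp: W_def)
  have "has_tree d (g ` W) E'"
    unfolding has_tree_def
    by (rule exI[of _ "g \<circ> a"], rule exI[of _ "g \<circ> b"]) (use mem mem' ab E' in auto)
  moreover have "tree_bound (g ` W) E' \<le> enat d"
    using d 1 2 by (auto simp: is_tree_bound_for_def)
  ultimately show False by (simp add: tree_bound_le_iff)
qed

end

theory Submission
  imports Defs
begin

text \<open>
  Write \<open>F(x) = |A \<triangle> (A - x)| / |G|\<close> for the relative \<^emph>\<open>defect\<close> of \<open>x\<close>. It is symmetric and subadditive,
  so the elements with \<open>F(x) \<le> \<theta>\<close> form a subgroup \<open>H\<close> as soon as \<open>F\<close> has a \<^emph>\<open>gap\<close>, that is, takes no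
  value \<open>v\<close> with \<open>\<theta> < v \<le> \<delta>\<close>, for some \<open>\<delta> \<ge> 2 \<theta>\<close>. The stability of \<open>A\<close> enters only through the
  absence of trees of height \<open>d\<close> in the Cayley graph, and is used twice.

  First, it bounds the index of \<open>H\<close>. Representatives \<open>x\<close> of the cosets of \<open>H\<close> give translates \<open>A - x\<close>
  that differ pairwise in more than \<open>\<delta> |G|\<close> points. Some point splits such a family into two
  parts, each containing at least a proportion \<open>\<delta> / 4\<close> of it. Iterating this builds a tree, so
  there are fewer than \<open>(4 / \<delta>) ^ d\<close> cosets (\<open>many_separated_imp_tree\<close>, \<open>gap_subgroup_index\<close>).

  Secondly, it provides the gap. Take \<open>d\<close> intervals, each far below the previous one. If every
  interval contained a defect, there would be elements \<open>x\<^sub>1, \<dots>, x\<^sub>d\<close> with rapidly decreasing defects.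
  Among the many points that \<open>x\<^sub>i\<close> moves into \<open>A\<close>, some are unaffected by sums of later \<open>x\<^sub>j\<close>, and
  translates of such points are the branching vertices of a tree of height \<open>d\<close> whose leaves are
  the subset sums of the \<open>x\<^sub>i\<close> (\<open>lacunary_imp_tree\<close>). So one of the \<open>d\<close> intervals is a gap.

  Finally, averaging \<open>F\<close> over \<open>H\<close> shows that on a coset where \<open>A\<close> has density \<open>\<alpha>\<close>, the quantity
  \<open>2 \<alpha> (1 - \<alpha>)\<close> is at most \<open>\<theta>\<close> times the index of \<open>H\<close> (\<open>almost_invariant_coset\<close>). The intervals are
  chosen so that \<open>\<theta> (4 / \<delta>) ^ d < \<epsilon>\<close>, which forces \<open>\<alpha>\<close> or \<open>1 - \<alpha>\<close> to be at most \<open>\<epsilon>\<close>. Since \<open>N\<^sup>1(z)\<close> meets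
  a coset in a translate of the intersection of \<open>A\<close> with another coset, this is the required
  regularity. The ends \<open>\<delta>\<close> of the intervals are powers of \<open>\<epsilon> / 4\<close> with exponents growing like
  \<open>(d + 1) ^ i\<close>, so the index is at most \<open>(4 / \<epsilon>)\<close> to a power that is tiny in comparison with the
  tower \<open>D\<close> (\<open>index_exponent_le\<close>).
\<close>

section \<open>Trees with leaves in a given set\<close>

text \<open>
  A tree as in \<^const>\<open>has_tree\<close>, but unlabelled: only the set \<open>L\<close> from which the leaves are drawn is
  recorded, and every branching vertex may be chosen afresh in its own subtree. This is the form
  in which trees are built from the root, by splitting a set of candidates for the leaves.
\<close>

primrec tree_in :: "'a set \<Rightarrow> ('a \<times> 'a) set \<Rightarrow> nat \<Rightarrow> 'a set \<Rightarrow> bool" where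
  "tree_in V E 0 L \<longleftrightarrow> L \<noteq> {}"
| "tree_in V E (Suc h) L \<longleftrightarrow>
     (\<exists>b\<in>V. tree_in V E h {a\<in>L. (a, b) \<in> E} \<and> tree_in V E h {a\<in>L. (a, b) \<notin> E})"

lemma tree_in_mono:
  assumes "tree_in V E h L" and "L \<subseteq> L'"
  shows "tree_in V E h L'"
  using assms
proof (induction h arbitrary: L L')
  case 0
  then show ?case by auto
next
  case (Suc h)
  from Suc.prems(1) obtain b where b: "b \<in> V"
    "tree_in V E h {a\<in>L. (a, b) \<in> E}" "tree_in V E h {a\<in>L. (a, b) \<notin> E}"
    by auto
  have "tree_in V E h {a\<in>L'. (a, b) \<in> E}" "tree_in V E h {a\<in>L'. (a, b) \<notin> E}"
    by (rule Suc.IH[OF b(2)] Suc.IH[OF b(3)], use Suc.prems(2) in auto)+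
  with b(1) show ?case by auto
qed

lemma tree_in_imp_has_tree:
  assumes "tree_in V E h V"
  shows "has_tree h V E"
proof -
  have "\<exists>a b. (\<forall>\<eta>. length \<eta> = h \<longrightarrow> a \<eta> \<in> L) \<and> (\<forall>\<rho>. length \<rho> < h \<longrightarrow> b \<rho> \<in> V) \<and>
          (\<forall>\<eta> \<rho>. length \<eta> = h \<longrightarrow> length \<rho> < h \<longrightarrow> strict_prefix \<rho> \<eta> \<longrightarrow>
             ((a \<eta>, b \<rho>) \<in> E \<longleftrightarrow> prefix (\<rho> @ [True]) \<eta>))"
    if "tree_in V E h L" for L
    using that
  proof (induction h arbitrary: L)
    case 0
    then show ?case by auto
  next
    case (Suc h)
    then obtain r where r: "r \<in> V"
      "tree_in V E h {a\<in>L. (a, r) \<in> E}" "tree_in V E h {a\<in>L. (a, r) \<notin> E}"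
      by auto
    obtain a1 b1 where 1: "\<And>\<eta>. length \<eta> = h \<Longrightarrow> a1 \<eta> \<in> {a\<in>L. (a, r) \<in> E}"
      "\<And>\<rho>. length \<rho> < h \<Longrightarrow> b1 \<rho> \<in> V"
      "\<And>\<eta> \<rho>. length \<eta> = h \<Longrightarrow> length \<rho> < h \<Longrightarrow> strict_prefix \<rho> \<eta> \<Longrightarrow>
             ((a1 \<eta>, b1 \<rho>) \<in> E \<longleftrightarrow> prefix (\<rho> @ [True]) \<eta>)"
      using Suc.IH[OF r(2)] by blast
    obtain a0 b0 where 0: "\<And>\<eta>. length \<eta> = h \<Longrightarrow> a0 \<eta> \<in> {a\<in>L. (a, r) \<notin> E}"
      "\<And>\<rho>. length \<rho> < h \<Longrightarrow> b0 \<rho> \<in> V"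
      "\<And>\<eta> \<rho>. length \<eta> = h \<Longrightarrow> length \<rho> < h \<Longrightarrow> strict_prefix \<rho> \<eta> \<Longrightarrow>
             ((a0 \<eta>, b0 \<rho>) \<in> E \<longleftrightarrow> prefix (\<rho> @ [True]) \<eta>)"
      using Suc.IH[OF r(3)] by blast
    \<comment> \<open>The first letter of a string chooses between the two subtrees.\<close>
    define a where "a \<eta> = (if hd \<eta> then a1 (tl \<eta>) else a0 (tl \<eta>))" for \<eta>
    define b where "b \<rho> = (if \<rho> = [] then r else if hd \<rho> then b1 (tl \<rho>) else b0 (tl \<rho>))" for \<rho>
    have "a \<eta> \<in> L" if "length \<eta> = Suc h" for \<eta>
      using that 0(1) 1(1) by (auto simp: a_def length_Suc_conv)
    moreover have "b \<rho> \<in> V" if "length \<rho> < Suc h" for \<rho>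
      using that r(1) 0(2) 1(2) by (cases \<rho>) (auto simp: b_def)
    moreover have "(a \<eta>, b \<rho>) \<in> E \<longleftrightarrow> prefix (\<rho> @ [True]) \<eta>"
      if len: "length \<eta> = Suc h" and "length \<rho> < Suc h" "strict_prefix \<rho> \<eta>" for \<eta> \<rho>
    proof -
      obtain c \<eta>' where \<eta>: "\<eta> = c # \<eta>'" "length \<eta>' = h"
        using len by (cases \<eta>) auto
      show ?thesis
      proof (cases \<rho>)
        case Nil
        then show ?thesis using \<eta> 0(1)[of \<eta>'] 1(1)[of \<eta>'] by (auto simp: a_def b_def)
      next
        case (Cons e \<rho>')
        then have "e = c" "strict_prefix \<rho>' \<eta>'" "length \<rho>' < h"
          using that \<eta> by auto
        then show ?thesis using Cons \<eta> 0(3)[of \<eta>' \<rho>'] 1(3)[of \<eta>' \<rho>']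
          by (auto simp: a_def b_def)
      qed
    qed
    ultimately show ?case by (intro exI[of _ a] exI[of _ b]) simp
  qed
  from this[OF assms] show ?thesis unfolding has_tree_def by blast
qed

section \<open>Separated families of neighbourhoods\<close>

lemma card_filter_add_card_filter_not:
  assumes "finite K"
  shows "card {y\<in>K. P y} + card {y\<in>K. \<not> P y} = card K"
proof -
  have "card ({y\<in>K. P y} \<union> {y\<in>K. \<not> P y}) = card {y\<in>K. P y} + card {y\<in>K. \<not> P y}"
    by (rule card_Un_disjoint) (use assms in auto)
  moreover have "{y\<in>K. P y} \<union> {y\<in>K. \<not> P y} = K" by blast
  ultimately show ?thesis by simp
qed

lemma sum_disagreements:
  assumes "finite F"
  shows "(\<Sum>x\<in>F. \<Sum>y\<in>F. of_bool (P x \<noteq> P y) :: real)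
         = 2 * real (card {x\<in>F. P x}) * real (card {x\<in>F. \<not> P x})"
proof -
  have "(\<Sum>y\<in>F. of_bool (P x \<noteq> P y) :: real)
      = (if P x then real (card {x\<in>F. \<not> P x}) else real (card {x\<in>F. P x}))" for x
    using assms by (auto simp: sum_of_bool_eq Int_def)
  then show ?thesis
    using assms by (simp add: sum.If_cases Int_def)
qed

text \<open>
  Averaging over \<open>b\<close>: a pair of distinct points of \<open>F\<close> is separated by more than \<open>\<delta> |V|\<close> vertices,
  so some \<open>b\<close> separates at least a proportion \<open>\<delta>\<close> of the ordered pairs. It cuts \<open>F\<close> into parts of
  sizes \<open>p\<close> and \<open>q\<close> with \<open>2 p q \<ge> \<delta> |F| (|F| - 1) \<ge> \<delta> |F|\<^sup>2 / 2\<close>. As neither part exceeds \<open>|F|\<close>,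
  both have at least \<open>\<delta> |F| / 4\<close> elements.
\<close>

lemma separating_point:
  fixes \<delta> :: real
  assumes V: "finite V" and F: "finite F" "card F \<ge> 2"
    and sep: "\<And>x y. x \<in> F \<Longrightarrow> y \<in> F \<Longrightarrow> x \<noteq> y \<Longrightarrow>
      \<delta> * card V < card {b\<in>V. (x, b) \<in> E \<longleftrightarrow> (y, b) \<notin> E}"
    and \<delta>: "\<delta> \<ge> 0"
  obtains b where "b \<in> V" "\<delta> / 4 * card F \<le> card {a\<in>F. (a, b) \<in> E}"
    "\<delta> / 4 * card F \<le> card {a\<in>F. (a, b) \<notin> E}"
proof -
  define N where "N = real (card F)"
  have N: "N \<ge> 2" using F by (simp add: N_def)
  define p q where "p b = real (card {a\<in>F. (a, b) \<in> E})"
    and "q b = real (card {a\<in>F. (a, b) \<notin> E})" for b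
  have pq: "p b + q b = N" for b
    unfolding p_def q_def N_def of_nat_add[symmetric]
    by (simp only: card_filter_add_card_filter_not[OF F(1)])
  have pq0: "p b \<ge> 0" "q b \<ge> 0" for b by (auto simp: p_def q_def)
  have dc: "(\<Sum>b\<in>V. 2 * p b * q b)
      = (\<Sum>x\<in>F. \<Sum>y\<in>F. real (card {b\<in>V. (x, b) \<in> E \<longleftrightarrow> (y, b) \<notin> E}))"
  proof -
    have "(\<Sum>b\<in>V. 2 * p b * q b)
        = (\<Sum>b\<in>V. \<Sum>x\<in>F. \<Sum>y\<in>F. of_bool (((x, b) \<in> E) \<noteq> ((y, b) \<in> E)) :: real)"
      using sum_disagreements[OF F(1), of "\<lambda>a. (a, _) \<in> E"] by (simp add: p_def q_def)
    also have "\<dots> = (\<Sum>x\<in>F. \<Sum>y\<in>F. \<Sum>b\<in>V. of_bool (((x, b) \<in> E) \<noteq> ((y, b) \<in> E)) :: real)"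
      by (subst sum.swap, rule sum.cong[OF refl], rule sum.swap)
    also have "\<dots> = (\<Sum>x\<in>F. \<Sum>y\<in>F. real (card {b\<in>V. (x, b) \<in> E \<longleftrightarrow> (y, b) \<notin> E}))"
      using V by (simp add: sum_of_bool_eq Int_def)
    finally show ?thesis .
  qed
  have "(\<Sum>b\<in>V. \<delta> * N\<^sup>2 / 2) \<le> (\<Sum>b\<in>V. 2 * p b * q b)"
  proof -
    have "\<delta> * card V * (N - 1) \<le> (\<Sum>y\<in>F. real (card {b\<in>V. (x, b) \<in> E \<longleftrightarrow> (y, b) \<notin> E}))"
      if x: "x \<in> F" for x
    proof -
      have "\<delta> * card V * (N - 1) = (\<Sum>y\<in>F - {x}. \<delta> * card V)"
        using F x N by (simp add: N_def card_Diff_singleton of_nat_diff)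
      also have "\<dots> \<le> (\<Sum>y\<in>F - {x}. real (card {b\<in>V. (x, b) \<in> E \<longleftrightarrow> (y, b) \<notin> E}))"
        using sep[OF x] by (intro sum_mono less_imp_le) auto
      also have "\<dots> \<le> (\<Sum>y\<in>F. real (card {b\<in>V. (x, b) \<in> E \<longleftrightarrow> (y, b) \<notin> E}))"
        using F by (intro sum_mono2) auto
      finally show ?thesis .
    qed
    then have "(\<Sum>x\<in>F. \<delta> * card V * (N - 1)) \<le> (\<Sum>b\<in>V. 2 * p b * q b)"
      unfolding dc by (intro sum_mono)
    then have "N * (\<delta> * card V * (N - 1)) \<le> (\<Sum>b\<in>V. 2 * p b * q b)"
      by (simp add: N_def)
    moreover have "card V * (\<delta> * N\<^sup>2 / 2) \<le> N * (\<delta> * card V * (N - 1))"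
    proof -
      have "N\<^sup>2 / 2 \<le> N * (N - 1)" using N by (simp add: power2_eq_square field_simps)
      from mult_left_mono[OF this, of "\<delta> * card V"] \<delta> show ?thesis by (simp add: mult_ac)
    qed
    ultimately show ?thesis by simp
  qed
  moreover have "V \<noteq> {}"
  proof
    assume "V = {}"
    moreover obtain x y where "x \<in> F" "y \<in> F" "x \<noteq> y"
      using F by (metis card_le_Suc0_iff_eq not_numeral_le_zero numeral_2_eq_2 not_less_eq_eq)
    ultimately show False using sep[of x y] by simp
  qed
  ultimately obtain b where b: "b \<in> V" "\<delta> * N\<^sup>2 / 2 \<le> 2 * p b * q b"
    using sum_strict_mono[of V "\<lambda>b. 2 * p b * q b" "\<lambda>b. \<delta> * N\<^sup>2 / 2"] V by force
  have "N * (\<delta> / 4 * N) \<le> N * p b" "N * (\<delta> / 4 * N) \<le> N * q b"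
  proof -
    have "p b * q b \<le> p b * N" "p b * q b \<le> N * q b"
      using pq[of b] pq0[of b] by (auto intro!: mult_left_mono mult_right_mono)
    with b(2) show "N * (\<delta> / 4 * N) \<le> N * p b" "N * (\<delta> / 4 * N) \<le> N * q b"
      by (auto simp: power2_eq_square field_simps)
  qed
  then have "\<delta> / 4 * N \<le> p b" "\<delta> / 4 * N \<le> q b"
    using N by auto
  with b(1) that show ?thesis by (auto simp: p_def q_def N_def)
qed

text \<open>
  Use a separating point as the root and recurse: each level costs a factor \<open>\<delta> / 4\<close> in the number
  of candidates for the leaves. Hence in a graph without trees of height \<open>h\<close>, a family of
  neighbourhoods that are pairwise \<open>\<delta>\<close>-separated has fewer than \<open>(4 / \<delta>) ^ h\<close> members.
\<close>

lemma many_separated_imp_tree: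
  fixes \<delta> :: real
  assumes V: "finite V" and F: "finite F" "card F \<ge> (4 / \<delta>) ^ h"
    and sep: "\<And>x y. x \<in> F \<Longrightarrow> y \<in> F \<Longrightarrow> x \<noteq> y \<Longrightarrow>
      \<delta> * card V < card {b\<in>V. (x, b) \<in> E \<longleftrightarrow> (y, b) \<notin> E}"
    and \<delta>: "0 < \<delta>" "\<delta> \<le> 1"
  shows "tree_in V E h F"
  using F sep
proof (induction h arbitrary: F)
  case 0
  then show ?case by auto
next
  case (Suc h)
  have "4 \<le> 4 / \<delta>" using \<delta> by (simp add: field_simps)
  moreover have "1 \<le> (4 / \<delta>) ^ h" using \<delta> by (intro one_le_power) (simp add: field_simps)
  ultimately have "4 * 1 \<le> (4 / \<delta>) * (4 / \<delta>) ^ h" using \<delta> by (intro mult_mono) auto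
  then have "real (card F) \<ge> 4" using Suc.prems(2) by simp
  then have "card F \<ge> 2" by linarith
  then obtain b where b: "b \<in> V" "\<delta> / 4 * card F \<le> card {a\<in>F. (a, b) \<in> E}"
    "\<delta> / 4 * card F \<le> card {a\<in>F. (a, b) \<notin> E}"
    by (rule separating_point[OF V Suc.prems(1) _ Suc.prems(3)]) (use \<delta> in auto)
  have "\<delta> / 4 * ((4 / \<delta>) * (4 / \<delta>) ^ h) \<le> \<delta> / 4 * card F"
    using Suc.prems(2) \<delta> by (intro mult_left_mono) auto
  then have big: "(4 / \<delta>) ^ h \<le> \<delta> / 4 * card F" using \<delta> by simp
  have "tree_in V E h {a\<in>F. (a, b) \<in> E}" "tree_in V E h {a\<in>F. (a, b) \<notin> E}"
    using order_trans[OF big b(2)] order_trans[OF big b(3)] Suc.prems(1,3)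
    by (intro Suc.IH; simp)+
  with b(1) show ?case by auto
qed

section \<open>Shift defects and lacunary sequences\<close>

text \<open>
  This is \<open>|A \<triangle> (A - x)|\<close>: the number of points whose membership in \<open>A\<close> is changed by adding \<open>x\<close>.
\<close>

definition shift_defect :: "('a, 'm) ring_scheme \<Rightarrow> 'a set \<Rightarrow> 'a \<Rightarrow> nat" where
  "shift_defect G A x = card {y\<in>carrier G. (y \<in> A) \<noteq> (x \<oplus>\<^bsub>G\<^esub> y \<in> A)}"

primrec subset_sums :: "('a, 'm) ring_scheme \<Rightarrow> 'a list \<Rightarrow> 'a set" where
  "subset_sums G [] = {\<zero>\<^bsub>G\<^esub>}"
| "subset_sums G (x # xs) = subset_sums G xs \<union> (\<lambda>s. x \<oplus>\<^bsub>G\<^esub> s) ` subset_sums G xs"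

text \<open>
  The sequence decreases so fast that \<open>f x\<close> still dominates after a union bound over all
  \<open>2 ^ length xs\<close> subset sums of the later terms, with room for two bad events for each of them.
\<close>

primrec lacunary :: "('a \<Rightarrow> nat) \<Rightarrow> 'a list \<Rightarrow> bool" where
  "lacunary f [] \<longleftrightarrow> True"
| "lacunary f (x # xs) \<longleftrightarrow> 4 * 2 ^ length xs * sum_list (map f xs) < f x \<and> lacunary f xs"

context abelian_group
begin

lemma card_translate:
  assumes "x \<in> carrier G"
  shows "card {y\<in>carrier G. Q (x \<oplus> y)} = card {y\<in>carrier G. Q y}"
proof (rule bij_betw_same_card[of "\<lambda>y. x \<oplus> y"])
  show "bij_betw (\<lambda>y. x \<oplus> y) {y\<in>carrier G. Q (x \<oplus> y)} {y\<in>carrier G. Q y}"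
    by (rule bij_betw_byWitness[where f' = "\<lambda>y. \<ominus> x \<oplus> y"])
       (use assms in \<open>auto simp: r_neg1 r_neg2\<close>)
qed

lemma shift_defect_zero [simp]: "shift_defect G A \<zero> = 0"
proof -
  have "{y\<in>carrier G. (y \<in> A) \<noteq> (\<zero> \<oplus> y \<in> A)} = {}" by auto
  then show ?thesis unfolding shift_defect_def by (simp only: card.empty)
qed

lemma shift_defect_minus:
  assumes "x \<in> carrier G"
  shows "shift_defect G A (\<ominus> x) = shift_defect G A x"
proof -
  have "shift_defect G A (\<ominus> x) = card {y\<in>carrier G. (x \<oplus> y \<in> A) \<noteq> (\<ominus> x \<oplus> (x \<oplus> y) \<in> A)}"
    unfolding shift_defect_def
    using card_translate[OF assms, of "\<lambda>y. (y \<in> A) \<noteq> (\<ominus> x \<oplus> y \<in> A)"] by simp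
  also have "{y\<in>carrier G. (x \<oplus> y \<in> A) \<noteq> (\<ominus> x \<oplus> (x \<oplus> y) \<in> A)}
      = {y\<in>carrier G. (y \<in> A) \<noteq> (x \<oplus> y \<in> A)}"
    using assms by (auto simp: r_neg1)
  finally show ?thesis by (simp only: shift_defect_def)
qed

lemma shift_defect_add:
  assumes "finite (carrier G)" "x \<in> carrier G" "y \<in> carrier G"
  shows "shift_defect G A (x \<oplus> y) \<le> shift_defect G A x + shift_defect G A y"
proof -
  let ?X = "{z\<in>carrier G. (y \<oplus> z \<in> A) \<noteq> (x \<oplus> (y \<oplus> z) \<in> A)}"
  let ?Y = "{z\<in>carrier G. (z \<in> A) \<noteq> (y \<oplus> z \<in> A)}"
  have "shift_defect G A (x \<oplus> y) \<le> card (?X \<union> ?Y)"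
    unfolding shift_defect_def using assms by (intro card_mono) (auto simp: a_assoc)
  also have "\<dots> \<le> card ?X + card ?Y" by (rule card_Un_le)
  also have "card ?X = shift_defect G A x"
    unfolding shift_defect_def
    using card_translate[OF assms(3), of "\<lambda>z. (z \<in> A) \<noteq> (x \<oplus> z \<in> A)"] by simp
  finally show ?thesis by (simp only: shift_defect_def)
qed

text \<open>
  The neighbourhoods of \<open>x\<close> and \<open>y\<close> are the translates \<open>A - x\<close> and \<open>A - y\<close>, so separation in the
  Cayley graph is measured by the defect of the difference.
\<close>

lemma card_separating_points:
  assumes "x \<in> carrier G" "y \<in> carrier G"
  shows "card {b\<in>carrier G. (x, b) \<in> cayley_edges G A \<longleftrightarrow> (y, b) \<notin> cayley_edges G A}
         = shift_defect G A (y \<ominus> x)"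
proof -
  have "(y \<ominus> x) \<oplus> (x \<oplus> b) = y \<oplus> b" if "b \<in> carrier G" for b
    using that assms by (simp add: minus_eq a_assoc r_neg1)
  then have "{b\<in>carrier G. (x, b) \<in> cayley_edges G A \<longleftrightarrow> (y, b) \<notin> cayley_edges G A}
      = {b\<in>carrier G. (x \<oplus> b \<in> A) \<noteq> ((y \<ominus> x) \<oplus> (x \<oplus> b) \<in> A)}"
    using assms by (auto simp: cayley_edges_def)
  then show ?thesis
    unfolding shift_defect_def
    using card_translate[OF assms(1), of "\<lambda>b. (b \<in> A) \<noteq> ((y \<ominus> x) \<oplus> b \<in> A)"] by simp
qed

text \<open>
  As \<open>A\<close> and \<open>A - x\<close> have the same size, as many points leave \<open>A\<close> under the shift by \<open>x\<close> as enter it.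
\<close>

lemma card_entering_points:
  assumes fin: "finite (carrier G)" and x: "x \<in> carrier G"
  shows "2 * card {y\<in>carrier G. y \<notin> A \<and> x \<oplus> y \<in> A} = shift_defect G A x"
proof -
  let ?in = "{y\<in>carrier G. y \<notin> A \<and> x \<oplus> y \<in> A}" and ?out = "{y\<in>carrier G. y \<in> A \<and> x \<oplus> y \<notin> A}"
  let ?both = "{y\<in>carrier G. y \<in> A \<and> x \<oplus> y \<in> A}"
  have "card ?in + card ?both = card (?in \<union> ?both)"
    by (rule card_Un_disjoint[symmetric]) (use fin in auto)
  also have "?in \<union> ?both = {y\<in>carrier G. x \<oplus> y \<in> A}" by blast
  also have "card \<dots> = card {y\<in>carrier G. y \<in> A}" by (rule card_translate[OF x])
  also have "{y\<in>carrier G. y \<in> A} = ?out \<union> ?both" by blast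
  also have "card \<dots> = card ?out + card ?both"
    by (rule card_Un_disjoint) (use fin in auto)
  finally have "card ?in = card ?out" by simp
  moreover have "card ?in + card ?out = card (?in \<union> ?out)"
    by (rule card_Un_disjoint[symmetric]) (use fin in auto)
  moreover have "?in \<union> ?out = {y\<in>carrier G. (y \<in> A) \<noteq> (x \<oplus> y \<in> A)}" by blast
  ultimately show ?thesis by (simp only: shift_defect_def mult_2)
qed

lemma subset_sums_carrier: "set xs \<subseteq> carrier G \<Longrightarrow> subset_sums G xs \<subseteq> carrier G"
  by (induction xs) auto

lemma finite_subset_sums: "finite (subset_sums G xs)"
  by (induction xs) auto

lemma card_subset_sums: "card (subset_sums G xs) \<le> 2 ^ length xs"
proof (induction xs)
  case (Cons x xs)
  have "card (subset_sums G (x # xs))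
      \<le> card (subset_sums G xs) + card ((\<lambda>s. x \<oplus> s) ` subset_sums G xs)"
    by (simp add: card_Un_le)
  also have "\<dots> \<le> card (subset_sums G xs) + card (subset_sums G xs)"
    by (intro add_left_mono card_image_le finite_subset_sums)
  finally show ?case using Cons by simp
qed simp

lemma shift_defect_subset_sum:
  assumes "finite (carrier G)" "set xs \<subseteq> carrier G" "s \<in> subset_sums G xs"
  shows "shift_defect G A s \<le> sum_list (map (shift_defect G A) xs)"
  using assms(2,3)
proof (induction xs arbitrary: s)
  case (Cons x xs)
  consider "s \<in> subset_sums G xs" | t where "t \<in> subset_sums G xs" "s = x \<oplus> t"
    using Cons.prems by auto
  then show ?case
  proof cases
    case 1
    then have "shift_defect G A s \<le> sum_list (map (shift_defect G A) xs)"
      using Cons.IH Cons.prems by simp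
    then show ?thesis by simp
  next
    case 2
    then have "t \<in> carrier G" "x \<in> carrier G"
      using Cons.prems subset_sums_carrier[of xs] by auto
    from shift_defect_add[OF assms(1) this(2,1), of A] Cons.IH[OF _ 2(1)] 2(2) Cons.prems
    show ?thesis by simp
  qed
qed simp

text \<open>
  A point \<open>y\<close> that enters \<open>A\<close> when \<open>x\<close> is added, such that further subset sums of \<open>xs\<close> change the
  membership of neither \<open>y\<close> nor \<open>x \<oplus> y\<close>. Half of the defect of \<open>x\<close> counts entering points, and
  those spoilt by some subset sum are fewer by lacunarity.
\<close>

lemma robust_entering_point:
  assumes fin: "finite (carrier G)" and x: "x \<in> carrier G" and xs: "set xs \<subseteq> carrier G"
    and lac: "4 * 2 ^ length xs * sum_list (map (shift_defect G A) xs) < shift_defect G A x"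
  obtains y where "y \<in> carrier G" "\<And>s. s \<in> subset_sums G xs \<Longrightarrow> s \<oplus> y \<notin> A"
    "\<And>s. s \<in> subset_sums G xs \<Longrightarrow> s \<oplus> (x \<oplus> y) \<in> A"
proof -
  let ?S = "subset_sums G xs" and ?\<sigma> = "sum_list (map (shift_defect G A) xs)"
  define bad where "bad s = {y\<in>carrier G. (y \<in> A) \<noteq> (s \<oplus> y \<in> A)}
    \<union> {y\<in>carrier G. (x \<oplus> y \<in> A) \<noteq> (s \<oplus> (x \<oplus> y) \<in> A)}" for s
  let ?Y = "{y\<in>carrier G. y \<notin> A \<and> x \<oplus> y \<in> A}"
  have bad: "card (bad s) \<le> 2 * ?\<sigma>" if "s \<in> ?S" for s
  proof -
    have "card (bad s) \<le> card {y\<in>carrier G. (y \<in> A) \<noteq> (s \<oplus> y \<in> A)}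
        + card {y\<in>carrier G. (x \<oplus> y \<in> A) \<noteq> (s \<oplus> (x \<oplus> y) \<in> A)}"
      unfolding bad_def by (rule card_Un_le)
    also have "\<dots> = shift_defect G A s + shift_defect G A s"
      unfolding shift_defect_def
      using card_translate[OF x, of "\<lambda>y. (y \<in> A) \<noteq> (s \<oplus> y \<in> A)"] by simp
    finally have "card (bad s) \<le> shift_defect G A s + shift_defect G A s" .
    with shift_defect_subset_sum[OF fin xs that, of A] show ?thesis by linarith
  qed
  have "card (\<Union>s\<in>?S. bad s) \<le> (\<Sum>s\<in>?S. card (bad s))"
    by (rule card_UN_le[OF finite_subset_sums])
  also have "\<dots> \<le> card ?S * (2 * ?\<sigma>)"
    using sum_bounded_above[of ?S "\<lambda>s. card (bad s)" "2 * ?\<sigma>"] bad by simp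
  also have "\<dots> \<le> 2 ^ length xs * (2 * ?\<sigma>)"
    by (rule mult_right_mono[OF card_subset_sums]) simp
  finally have "2 * card (\<Union>s\<in>?S. bad s) < 2 * card ?Y"
    using lac card_entering_points[OF fin x, of A] by simp
  then have "\<not> ?Y \<subseteq> (\<Union>s\<in>?S. bad s)"
    using card_mono[of "\<Union>s\<in>?S. bad s" ?Y] fin finite_subset_sums by (auto simp: bad_def)
  then obtain y where y: "y \<in> ?Y" "\<And>s. s \<in> ?S \<Longrightarrow> y \<notin> bad s" by blast
  show ?thesis
  proof (rule that[of y])
    show "y \<in> carrier G" using y(1) by simp
    show "s \<oplus> y \<notin> A" "s \<oplus> (x \<oplus> y) \<in> A" if "s \<in> ?S" for s
      using y(1) y(2)[OF that] by (auto simp: bad_def)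
  qed
qed

text \<open>
  The leaves of the tree are the subset sums, translated by \<open>c\<close>; the branching at a vertex decides
  whether the current largest term is included. A robust entering point \<open>y\<close> for that term gives
  the branching vertex \<open>y - c\<close>: whether \<open>y\<close> is moved into \<open>A\<close> depends on this one decision only.
\<close>

lemma lacunary_imp_tree:
  assumes fin: "finite (carrier G)"
  shows "set xs \<subseteq> carrier G \<Longrightarrow> lacunary (shift_defect G A) xs \<Longrightarrow> c \<in> carrier G \<Longrightarrow>
    tree_in (carrier G) (cayley_edges G A) (length xs) ((\<lambda>s. c \<oplus> s) ` subset_sums G xs)"
proof (induction xs arbitrary: c)
  case (Cons x xs)
  let ?S = "subset_sums G xs" and ?E = "cayley_edges G A"
  let ?L = "(\<lambda>s. c \<oplus> s) ` subset_sums G (x # xs)"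
  have x: "x \<in> carrier G" "set xs \<subseteq> carrier G" and c: "c \<in> carrier G" using Cons.prems by auto
  have S: "s \<in> carrier G" if "s \<in> ?S" for s using that subset_sums_carrier[OF x(2)] by auto
  obtain y where y: "y \<in> carrier G" "\<And>s. s \<in> ?S \<Longrightarrow> s \<oplus> y \<notin> A"
    "\<And>s. s \<in> ?S \<Longrightarrow> s \<oplus> (x \<oplus> y) \<in> A"
    by (rule robust_entering_point[OF fin x]) (use Cons.prems in auto)
  define b where "b = \<ominus> c \<oplus> y"
  have b: "b \<in> carrier G" using c y(1) by (simp add: b_def)
  have cb: "(c \<oplus> s) \<oplus> b = s \<oplus> y" if "s \<in> carrier G" for s
  proof -
    have "(c \<oplus> s) \<oplus> b = s \<oplus> (c \<oplus> (\<ominus> c \<oplus> y))"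
      using that c y(1) by (simp add: b_def a_ac)
    then show ?thesis using c y(1) by (simp add: r_neg2)
  qed
  have "tree_in (carrier G) ?E (length xs) ((\<lambda>s. c \<oplus> s) ` ?S)"
    using Cons.IH[OF x(2) _ c] Cons.prems(2) by simp
  moreover have "(\<lambda>s. c \<oplus> s) ` ?S \<subseteq> {a\<in>?L. (a, b) \<notin> ?E}"
    using cb S y(2) by (auto simp: cayley_edges_def)
  ultimately have 0: "tree_in (carrier G) ?E (length xs) {a\<in>?L. (a, b) \<notin> ?E}"
    by (rule tree_in_mono)
  have "tree_in (carrier G) ?E (length xs) ((\<lambda>s. (c \<oplus> x) \<oplus> s) ` ?S)"
    using Cons.IH[OF x(2)] Cons.prems(2) c x(1) by simp
  moreover have "(\<lambda>s. (c \<oplus> x) \<oplus> s) ` ?S \<subseteq> {a\<in>?L. (a, b) \<in> ?E}"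
  proof (rule image_subsetI)
    fix s assume s: "s \<in> ?S"
    have "(c \<oplus> x) \<oplus> s = c \<oplus> (x \<oplus> s)" using c x S[OF s] by (simp add: a_assoc)
    moreover have "(x \<oplus> s) \<oplus> y = s \<oplus> (x \<oplus> y)" using x S[OF s] y(1) by (simp add: a_ac)
    ultimately show "(c \<oplus> x) \<oplus> s \<in> {a\<in>?L. (a, b) \<in> ?E}"
      using s S[OF s] cb[of "x \<oplus> s"] y(3)[OF s] b c x by (auto simp: cayley_edges_def)
  qed
  ultimately have "tree_in (carrier G) ?E (length xs) {a\<in>?L. (a, b) \<in> ?E}"
    by (rule tree_in_mono)
  with 0 b show ?case by auto
qed simp

end

section \<open>A gap among the defects\<close>

text \<open>
  For \<open>q = \<epsilon> / 4\<close>, the scales are \<open>\<delta>\<^sub>i = q ^ e\<^sub>i\<close> and \<open>\<theta>\<^sub>i = q \<cdot> (q \<delta>\<^sub>i) ^ d = q ^ (d e\<^sub>i + d + 1)\<close>, where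
  \<open>e\<^sub>i\<close> is the exponent defined here. A subgroup cut out at scale \<open>\<delta>\<^sub>i\<close> has index at most
  \<open>(4 / \<delta>\<^sub>i) ^ d\<close>, and \<open>\<theta>\<^sub>i (4 / \<delta>\<^sub>i) ^ d = q \<epsilon> ^ d < \<epsilon>\<close>. The next scale is \<open>\<delta>\<^sub>i\<^sub>+\<^sub>1 = \<theta>\<^sub>i q ^ (d + 1)\<close>; the
  factor \<open>q ^ (d + 1) \<le> 4 ^ (- d - 1)\<close> makes elements chosen from successive scales lacunary.
\<close>

primrec scale_exp :: "nat \<Rightarrow> nat \<Rightarrow> nat" where
  "scale_exp d 0 = 0"
| "scale_exp d (Suc i) = d * (scale_exp d i + 2) + 2"

definition defect_gap :: "('a, 'm) ring_scheme \<Rightarrow> 'a set \<Rightarrow> real \<Rightarrow> real \<Rightarrow> bool" where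
  "defect_gap G A \<theta> \<delta> \<longleftrightarrow>
     (\<forall>x\<in>carrier G. real (shift_defect G A x) \<le> \<delta> * card (carrier G) \<longrightarrow>
        real (shift_defect G A x) \<le> \<theta> * card (carrier G))"

context abelian_group
begin

text \<open>
  If each of the intervals between \<open>\<theta>\<^sub>i\<close> and \<open>\<delta>\<^sub>i\<close> contains a defect, choose one element for each.
  The induction puts larger scales in front, so the bound \<open>\<delta>\<^sub>j\<close> on all later terms is carried along.
\<close>

lemma no_gap_imp_lacunary:
  fixes q :: real
  assumes q: "0 < q" "4 * q \<le> 1"
    and no_gap: "\<And>i. i < d \<Longrightarrow>
      \<not> defect_gap G A (q ^ (d * scale_exp d i + d + 1)) (q ^ scale_exp d i)"
  shows "j + h \<le> d \<Longrightarrow> \<exists>xs. length xs = h \<and> set xs \<subseteq> carrier G \<and> lacunary (shift_defect G A) xs \<and>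
    (\<forall>x\<in>set xs. real (shift_defect G A x) \<le> q ^ scale_exp d j * card (carrier G))"
proof (induction h arbitrary: j)
  case 0
  then show ?case by auto
next
  case (Suc h)
  let ?N = "real (card (carrier G))" and ?F = "shift_defect G A"
  let ?e = "scale_exp d j"
  from Suc.IH[of "Suc j"] Suc.prems obtain xs where xs: "length xs = h" "set xs \<subseteq> carrier G"
    "lacunary ?F xs" "\<And>x. x \<in> set xs \<Longrightarrow> real (?F x) \<le> q ^ scale_exp d (Suc j) * ?N"
    by auto
  from no_gap[of j] Suc.prems obtain x where x: "x \<in> carrier G"
    "real (?F x) \<le> q ^ ?e * ?N" "q ^ (d * ?e + d + 1) * ?N < real (?F x)"
    by (auto simp: defect_gap_def not_le)
  have "real (sum_list (map ?F xs)) = sum_list (map (\<lambda>x. real (?F x)) xs)"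
    by (induction xs) auto
  also have "\<dots> \<le> sum_list (map (\<lambda>x. q ^ scale_exp d (Suc j) * ?N) xs)"
    by (rule sum_list_mono) (rule xs(4))
  also have "\<dots> = h * (q ^ scale_exp d (Suc j) * ?N)"
    using xs(1) by (simp add: sum_list_triv)
  finally have sum_le: "real (sum_list (map ?F xs)) \<le> h * (q ^ scale_exp d (Suc j) * ?N)" .
  \<comment> \<open>The factor \<open>q ^ (d + 1)\<close> between \<open>\<theta>\<^sub>j\<close> and the next scale pays for the \<open>h\<close> summands and the
    \<open>2 ^ h\<close> subset sums, since \<open>4 \<cdot> 2 ^ h \<cdot> h \<le> 4 ^ (d + 1)\<close>.\<close>
  have "real h \<le> 2 ^ h" by (simp add: of_nat_less_two_power less_imp_le)
  then have "4 * 2 ^ h * real h \<le> 4 * 2 ^ h * (2 ^ h :: real)" by (intro mult_left_mono) auto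
  also have "\<dots> = 4 ^ Suc h" by (simp flip: power_mult_distrib)
  also have "\<dots> \<le> 4 ^ (d + 1)" using Suc.prems by (intro power_increasing) auto
  finally have "4 * 2 ^ h * real h * q ^ (d + 1) \<le> 4 ^ (d + 1) * q ^ (d + 1)"
    using q by (intro mult_right_mono) auto
  also have "\<dots> \<le> 1" using q unfolding power_mult_distrib[symmetric] by (intro power_le_one) auto
  finally have small: "4 * 2 ^ h * real h * q ^ (d + 1) \<le> 1" .
  have "real (4 * 2 ^ h * sum_list (map ?F xs)) \<le> 4 * 2 ^ h * (h * (q ^ scale_exp d (Suc j) * ?N))"
    using sum_le by simp
  also have "scale_exp d (Suc j) = (d * ?e + d + 1) + (d + 1)" by (simp add: algebra_simps)
  also have "4 * 2 ^ h * (h * (q ^ ((d * ?e + d + 1) + (d + 1)) * ?N))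
      = (4 * 2 ^ h * real h * q ^ (d + 1)) * (q ^ (d * ?e + d + 1) * ?N)"
    unfolding power_add[of q "d * ?e + d + 1"] by simp
  also have "\<dots> \<le> 1 * (q ^ (d * ?e + d + 1) * ?N)"
    using q by (intro mult_right_mono small) auto
  also have "\<dots> < real (?F x)" using x(3) by simp
  finally have "4 * 2 ^ h * sum_list (map ?F xs) < ?F x" by (simp only: of_nat_less_iff)
  moreover have "q ^ scale_exp d (Suc j) * ?N \<le> q ^ ?e * ?N"
  proof (intro mult_right_mono power_decreasing)
    have "?e \<le> d * ?e" using Suc.prems by (cases d) auto
    then show "?e \<le> scale_exp d (Suc j)" unfolding scale_exp.simps distrib_left by linarith
  qed (use q in auto)
  ultimately show ?case
    using xs x by (intro exI[of _ "x # xs"]) (auto intro: order_trans)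
qed

text \<open>
  Without a gap at any of the first \<open>d\<close> scales there would be a lacunary sequence of length \<open>d\<close>,
  and with it a tree of height \<open>d\<close>.
\<close>

lemma defect_gap_exists:
  fixes q :: real
  assumes fin: "finite (carrier G)" and q: "0 < q" "4 * q \<le> 1"
    and no_tree: "\<not> has_tree d (carrier G) (cayley_edges G A)"
  obtains i where "i < d"
    "defect_gap G A (q ^ (d * scale_exp d i + d + 1)) (q ^ scale_exp d i)"
proof (rule ccontr)
  assume "\<not> thesis"
  with that have "\<not> defect_gap G A (q ^ (d * scale_exp d i + d + 1)) (q ^ scale_exp d i)"
    if "i < d" for i using \<open>i < d\<close> by blast
  from no_gap_imp_lacunary[OF q this, of 0 d] obtain xs where
    xs: "length xs = d" "set xs \<subseteq> carrier G" "lacunary (shift_defect G A) xs"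
    by auto
  have "tree_in (carrier G) (cayley_edges G A) d ((\<lambda>s. \<zero> \<oplus> s) ` subset_sums G xs)"
    using lacunary_imp_tree[OF fin xs(2,3), of \<zero>] xs(1) by simp
  moreover have "(\<lambda>s. \<zero> \<oplus> s) ` subset_sums G xs \<subseteq> carrier G"
    using subset_sums_carrier[OF xs(2)] by auto
  ultimately show False
    using tree_in_imp_has_tree[OF tree_in_mono] no_tree by blast
qed

end

section \<open>The subgroup below a gap\<close>

context abelian_group
begin

text \<open>
  The defect is subadditive, so a sum of two elements of defect at most \<open>\<theta>\<close> has defect at most
  \<open>2 \<theta> \<le> \<delta>\<close>; by the gap it is then at most \<open>\<theta>\<close>.
\<close>

lemma gap_subgroup:
  fixes \<theta> \<delta> :: real
  assumes fin: "finite (carrier G)" and \<theta>: "0 \<le> \<theta>" "2 * \<theta> \<le> \<delta>"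
    and gap: "defect_gap G A \<theta> \<delta>"
  shows "additive_subgroup {x\<in>carrier G. real (shift_defect G A x) \<le> \<theta> * card (carrier G)} G"
proof (rule additive_subgroupI, rule add.subgroupI)
  let ?H = "{x\<in>carrier G. real (shift_defect G A x) \<le> \<theta> * card (carrier G)}"
  show "?H \<subseteq> carrier G" by auto
  show "?H \<noteq> {}" using \<theta> by (auto intro!: exI[of _ \<zero>])
  show "\<ominus> x \<in> ?H" if "x \<in> ?H" for x using that by (simp add: shift_defect_minus)
  show "x \<oplus> y \<in> ?H" if "x \<in> ?H" "y \<in> ?H" for x y
  proof -
    have xy: "x \<in> carrier G" "y \<in> carrier G" using that by auto
    have "real (shift_defect G A (x \<oplus> y)) \<le> 2 * \<theta> * card (carrier G)"
      using shift_defect_add[OF fin xy, of A] that by simp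
    also have "\<dots> \<le> \<delta> * card (carrier G)" by (intro mult_right_mono \<theta>) simp
    finally show ?thesis using gap xy by (auto simp: defect_gap_def)
  qed
qed

text \<open>
  Representatives of distinct cosets differ by an element outside the subgroup. By the gap its
  defect exceeds not only \<open>\<theta>\<close> but \<open>\<delta>\<close>, so the representatives are \<open>\<delta>\<close>-separated. Since the
  bound involves only the upper end \<open>\<delta>\<close> of the gap, \<open>\<theta>\<close> can be chosen small in terms of it.
\<close>

lemma gap_subgroup_index:
  fixes \<delta> \<theta> :: real and A
  defines "H \<equiv> {x\<in>carrier G. real (shift_defect G A x) \<le> \<theta> * card (carrier G)}"
  assumes fin: "finite (carrier G)" and H: "additive_subgroup H G"
    and gap: "defect_gap G A \<theta> \<delta>" and \<delta>: "0 < \<delta>" "\<delta> \<le> 1"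
    and no_tree: "\<not> has_tree d (carrier G) (cayley_edges G A)"
  shows "card (a_rcosets H) < (4 / \<delta>) ^ d"
proof (rule ccontr)
  interpret H: abelian_subgroup H G by (rule abelian_subgroupI3[OF H abelian_group_axioms])
  assume large: "\<not> ?thesis"
  define r where "r K = (SOME x. x \<in> K)" for K :: "'a set"
  have r: "r K \<in> K" "r K \<in> carrier G" "K = H +> r K" if K: "K \<in> a_rcosets H" for K
  proof -
    from K obtain g where g: "g \<in> carrier G" "K = H +> g"
      by (auto simp: A_RCOSETS_def')
    then have "g \<in> K" using H.a_rcos_self by simp
    then show 1: "r K \<in> K" unfolding r_def by (rule someI)
    then show "r K \<in> carrier G" using g H.a_elemrcos_carrier by blast
    show "K = H +> r K" using 1 g a_repr_independence H.a_subgroup by blast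
  qed
  have inj: "inj_on r (a_rcosets H)"
    by (rule inj_onI) (metis r(3))
  have finC: "finite (a_rcosets H)"
    using fin H.a_rcosets_part_G by (metis finite_UnionD)
  have "tree_in (carrier G) (cayley_edges G A) d (r ` (a_rcosets H))"
  proof (rule many_separated_imp_tree[OF fin _ _ _ \<delta>])
    show "finite (r ` (a_rcosets H))" using finC by simp
    show "(4 / \<delta>) ^ d \<le> card (r ` (a_rcosets H))"
      using large card_image[OF inj] by simp
    fix x y assume "x \<in> r ` (a_rcosets H)" "y \<in> r ` (a_rcosets H)" and ne: "x \<noteq> y"
    then obtain K L where K: "K \<in> a_rcosets H" "x = r K" and L: "L \<in> a_rcosets H" "y = r L" by blast
    have xy: "x \<in> carrier G" "y \<in> carrier G" using r K L by auto
    have "y \<ominus> x \<notin> H"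
    proof
      assume "y \<ominus> x \<in> H"
      then have "y \<in> H +> x"
        using H.a_rcos_module_minus[OF _ xy] by (metis H.a_rcos_module_rev minus_eq xy)
      then have "H +> x = H +> y" using a_repr_independence xy H.a_subgroup by blast
      then show False using r(3) K L ne by metis
    qed
    moreover have yx: "y \<ominus> x \<in> carrier G" using xy by simp
    ultimately have "\<not> real (shift_defect G A (y \<ominus> x)) \<le> \<theta> * card (carrier G)"
      unfolding H_def by blast
    with gap yx have "\<delta> * card (carrier G) < shift_defect G A (y \<ominus> x)"
      unfolding defect_gap_def by (meson not_le)
    then show "\<delta> * card (carrier G)
        < card {b\<in>carrier G. (x, b) \<in> cayley_edges G A \<longleftrightarrow> (y, b) \<notin> cayley_edges G A}"
      by (simp only: card_separating_points[OF xy])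
  qed
  moreover have "r ` (a_rcosets H) \<subseteq> carrier G" using r by auto
  ultimately show False
    using tree_in_imp_has_tree[OF tree_in_mono] no_tree by blast
qed

text \<open>
  Count the pairs in \<open>K \<times> K\<close> with exactly one member in \<open>A\<close>. Each such pair has the form
  \<open>(y, z \<oplus> y)\<close> for a unique \<open>z\<close> in \<open>H\<close>, and then contributes to the defect of \<open>z\<close>. The right-hand
  side is \<open>|H| \<cdot> \<theta> |G|\<close>, rewritten with the theorem of Lagrange.
\<close>

lemma almost_invariant_coset:
  fixes \<theta> :: real
  assumes fin: "finite (carrier G)" and H: "additive_subgroup H G"
    and inv: "\<And>z. z \<in> H \<Longrightarrow> real (shift_defect G A z) \<le> \<theta> * card (carrier G)"
    and K: "K \<in> a_rcosets H"
  shows "2 * real (card {y\<in>K. y \<in> A}) * real (card {y\<in>K. y \<notin> A})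
         \<le> \<theta> * card (a_rcosets H) * (real (card H))\<^sup>2"
proof -
  interpret H: additive_subgroup H G by fact
  from K obtain g where g: "g \<in> carrier G" "K = H +> g" by (auto simp: A_RCOSETS_def')
  have Hc: "H \<subseteq> carrier G" by (rule H.a_subset)
  have KG: "K \<subseteq> carrier G" using g Hc by (auto simp: a_r_coset_def')
  have finH: "finite H" "finite K" using fin Hc KG finite_subset by auto
  have bij: "bij_betw (\<lambda>z. z \<oplus> y) H K" if y: "y \<in> K" for y
  proof -
    have yG: "y \<in> carrier G" using y KG by auto
    have "K = H +> y" using a_repr_independence H.a_subgroup y g by blast
    then have "K = (\<lambda>z. z \<oplus> y) ` H" by (auto simp: a_r_coset_def')
    moreover have "inj_on (\<lambda>z. z \<oplus> y) H"
      using yG Hc by (auto simp: inj_on_def)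
    ultimately show ?thesis by (simp add: bij_betw_def)
  qed
  have "2 * real (card {y\<in>K. y \<in> A}) * real (card {y\<in>K. y \<notin> A})
      = (\<Sum>y\<in>K. \<Sum>y'\<in>K. of_bool ((y \<in> A) \<noteq> (y' \<in> A)))"
    using sum_disagreements[OF finH(2), of "\<lambda>y. y \<in> A"] by simp
  also have "\<dots> = (\<Sum>y\<in>K. \<Sum>z\<in>H. of_bool ((y \<in> A) \<noteq> (z \<oplus> y \<in> A)))"
    by (rule sum.cong[OF refl], rule sum.reindex_bij_betw[OF bij, symmetric])
  also have "\<dots> = (\<Sum>z\<in>H. \<Sum>y\<in>K. of_bool ((y \<in> A) \<noteq> (z \<oplus> y \<in> A)))"
    by (rule sum.swap)
  also have "\<dots> \<le> (\<Sum>z\<in>H. \<theta> * card (carrier G))"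
  proof (rule sum_mono)
    fix z assume z: "z \<in> H"
    have "(\<Sum>y\<in>K. of_bool ((y \<in> A) \<noteq> (z \<oplus> y \<in> A)) :: real)
        = real (card {y\<in>K. (y \<in> A) \<noteq> (z \<oplus> y \<in> A)})"
      using finH by (simp add: sum_of_bool_eq Int_def)
    also have "\<dots> \<le> real (shift_defect G A z)"
      unfolding shift_defect_def using fin KG by (intro of_nat_mono card_mono) auto
    also have "\<dots> \<le> \<theta> * card (carrier G)" by (rule inv[OF z])
    finally show "(\<Sum>y\<in>K. of_bool ((y \<in> A) \<noteq> (z \<oplus> y \<in> A))) \<le> \<theta> * card (carrier G)" .
  qed
  also have "\<dots> = \<theta> * card (a_rcosets H) * (real (card H))\<^sup>2"
  proof -
    have "card (carrier G) = card (a_rcosets H) * card H"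
      using add.lagrange_finite[OF fin H.a_subgroup] by (simp add: A_RCOSETS_def order_def)
    then show ?thesis by (simp add: power2_eq_square)
  qed
  finally show ?thesis .
qed

end

text \<open>
  The group-theoretic heart: in any finite abelian group, \<open>A\<close> is almost empty or almost full on every
  coset of a subgroup of index polynomial in \<open>1 / \<epsilon>\<close>. The subgroup consists of the elements below
  a gap. If both \<open>A\<close> and its complement had density above \<open>\<epsilon>\<close> on some coset, then, one of the two
  densities being at least \<open>1 / 2\<close>, twice their product would exceed \<open>\<epsilon>\<close>; but by almost invariance
  it is at most \<open>\<theta>\<close> times the index, which is less than \<open>\<epsilon>\<close>.
\<close>

lemma subgroup_deciding_set:
  fixes G (structure) and \<epsilon> :: real
  assumes G: "abelian_group G" and fin: "finite (carrier G)"
    and no_tree: "\<not> has_tree d (carrier G) (cayley_edges G A)" and \<epsilon>: "0 < \<epsilon>" "\<epsilon> < 1"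
  obtains H i where "additive_subgroup H G" "i < d"
    "card (a_rcosets H) \<le> (4 / \<epsilon>) ^ (d * (scale_exp d i + 1))"
    "\<And>K. K \<in> a_rcosets H \<Longrightarrow>
       real (card {y\<in>K. y \<in> A}) \<le> \<epsilon> * card K \<or> real (card {y\<in>K. y \<notin> A}) \<le> \<epsilon> * card K"
proof -
  interpret abelian_group G by fact
  define q where "q = \<epsilon> / 4"
  have q: "0 < q" "4 * q \<le> 1" "q \<le> 1 / 4" using \<epsilon> by (auto simp: q_def)
  obtain i where i: "i < d"
    and gap': "defect_gap G A (q ^ (d * scale_exp d i + d + 1)) (q ^ scale_exp d i)"
    by (rule defect_gap_exists[OF fin q(1,2) no_tree])
  define \<delta> \<theta> where "\<delta> = q ^ scale_exp d i" and "\<theta> = q ^ (d * scale_exp d i + d + 1)"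
  have gap: "defect_gap G A \<theta> \<delta>" using gap' by (simp add: \<delta>_def \<theta>_def)
  have \<delta>: "0 < \<delta>" "\<delta> \<le> 1" using q by (auto simp: \<delta>_def intro: power_le_one)
  have \<theta>: "0 < \<theta>" using q by (simp add: \<theta>_def)
  have \<theta>_eq: "\<theta> = q * (q * \<delta>) ^ d"
    by (simp add: \<theta>_def \<delta>_def power_mult_distrib power_add mult_ac flip: power_mult)
  have \<theta>\<delta>: "2 * \<theta> \<le> \<delta>"
  proof -
    have "(q * \<delta>) ^ d \<le> (q * \<delta>) ^ 1"
      using i q \<delta> by (intro power_decreasing) (auto simp: mult_le_one)
    also have "\<dots> \<le> \<delta>" using q \<delta> by (simp add: mult_left_le_one_le)
    finally have "q * (q * \<delta>) ^ d \<le> 1 / 4 * \<delta>" using q \<delta> by (intro mult_mono) auto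
    then show ?thesis using \<delta> by (simp add: \<theta>_eq)
  qed
  define H where "H = {x\<in>carrier G. real (shift_defect G A x) \<le> \<theta> * card (carrier G)}"
  have H: "additive_subgroup H G"
    unfolding H_def by (rule gap_subgroup[OF fin less_imp_le[OF \<theta>] \<theta>\<delta> gap])
  interpret H: additive_subgroup H G by (rule H)
  have "card (a_rcosets H) < (4 / \<delta>) ^ d"
    unfolding H_def by (rule gap_subgroup_index[OF fin H[unfolded H_def] gap \<delta> no_tree])
  then have index: "card (a_rcosets H) \<le> (4 / \<delta>) ^ d" by simp
  have "4 / \<delta> \<le> (4 / \<epsilon>) ^ (scale_exp d i + 1)"
  proof -
    have "4 / \<delta> = 4 * (4 / \<epsilon>) ^ scale_exp d i" by (simp add: \<delta>_def q_def power_divide)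
    also have "\<dots> \<le> (4 / \<epsilon>) * (4 / \<epsilon>) ^ scale_exp d i"
      using \<epsilon> by (intro mult_right_mono) (auto simp: field_simps)
    finally show ?thesis by simp
  qed
  then have "(4 / \<delta>) ^ d \<le> ((4 / \<epsilon>) ^ (scale_exp d i + 1)) ^ d"
    using \<delta> by (intro power_mono) auto
  also have "\<dots> = (4 / \<epsilon>) ^ (d * (scale_exp d i + 1))" by (metis mult.commute power_mult)
  finally have index': "card (a_rcosets H) \<le> (4 / \<epsilon>) ^ (d * (scale_exp d i + 1))"
    using index by linarith
  have "\<theta> * card (a_rcosets H) \<le> \<theta> * (4 / \<delta>) ^ d"
    using \<theta> index by (intro mult_left_mono) auto
  also have "\<dots> = q * (4 * q) ^ d" using \<delta> by (simp add: \<theta>_eq power_mult_distrib power_divide)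
  also have "\<dots> \<le> q * 1" using q by (intro mult_left_mono power_le_one) auto
  also have "\<dots> < \<epsilon>" using \<epsilon> by (simp add: q_def)
  finally have small: "\<theta> * card (a_rcosets H) < \<epsilon>" .
  have "real (card {y\<in>K. y \<in> A}) \<le> \<epsilon> * card K \<or> real (card {y\<in>K. y \<notin> A}) \<le> \<epsilon> * card K"
    if K: "K \<in> a_rcosets H" for K
  proof (rule ccontr)
    assume neg: "\<not> ?thesis"
    define m where "m = real (card K)"
    let ?a = "real (card {y\<in>K. y \<in> A})" and ?b = "real (card {y\<in>K. y \<notin> A})"
    have ab: "\<epsilon> * m < ?a" "\<epsilon> * m < ?b" using neg by (auto simp: m_def)
    have m: "card H = card K"
      using add.card_rcosets_equal[of K H] K H.a_subset by (simp add: A_RCOSETS_def)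
    have "finite K"
      using K fin H.a_subgroup add.rcosets_part_G[of H] by (metis A_RCOSETS_def Union_upper finite_subset)
    then have sum: "?a + ?b = m"
      unfolding m_def of_nat_add[symmetric] by (simp only: card_filter_add_card_filter_not)
    have m0: "0 \<le> m" by (simp add: m_def)
    have inv: "real (shift_defect G A z) \<le> \<theta> * card (carrier G)" if "z \<in> H" for z
      using that unfolding H_def by blast
    have "2 * ?a * ?b \<le> \<theta> * card (a_rcosets H) * (real (card H))\<^sup>2"
      by (rule almost_invariant_coset[OF fin H inv K])
    also have "\<dots> = \<theta> * card (a_rcosets H) * m\<^sup>2" by (simp only: m m_def)
    also have "\<dots> \<le> \<epsilon> * m\<^sup>2" using small by (intro mult_right_mono) auto
    finally have le: "2 * ?a * ?b \<le> \<epsilon> * m\<^sup>2" .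
    \<comment> \<open>Here \<open>y\<close> is the larger of the two cardinalities, and \<open>x\<close> the other one.\<close>
    have "\<epsilon> * m\<^sup>2 < 2 * ?a * ?b" if xy: "\<epsilon> * m < x" "m / 2 \<le> y" "x * y = ?a * ?b" for x y
    proof -
      have "0 < m" using sum ab m0 \<epsilon> by (smt (verit) mult_nonneg_nonneg)
      then have "(\<epsilon> * m) * (m / 2) < x * y"
        using xy \<epsilon> by (intro mult_less_le_imp_less) auto
      then show ?thesis using xy(3) by (simp add: power2_eq_square)
    qed
    from this[of ?a ?b] this[of ?b ?a] ab sum le show False by (simp add: mult.commute) linarith
  qed
  with H i index' that show ?thesis by blast
qed

section \<open>The size of the exponent\<close>

lemma scale_exp_le:
  assumes "0 < d"
  shows "scale_exp d i + 4 \<le> 4 * (d + 1) ^ i"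
proof (induction i)
  case (Suc i)
  have "scale_exp d (Suc i) + 4 \<le> (d + 1) * (scale_exp d i + 4)"
    using assms by (simp add: algebra_simps)
  also have "\<dots> \<le> (d + 1) * (4 * (d + 1) ^ i)" by (rule mult_le_mono2[OF Suc])
  finally show ?case by simp
qed simp

lemma f_fun_ge: "2 \<le> k \<Longrightarrow> 2 ^ (y + 3) \<le> f_fun k y"
proof -
  assume k: "2 \<le> k"
  have "2 ^ (y + 3) \<le> (2::nat) ^ (k + 1 + y)" using k by (intro power_increasing) auto
  also have "\<dots> \<le> (k + 1 + y) * 2 ^ (k + 1 + y)" by simp
  finally show ?thesis by (simp add: f_fun_def h_fun_def)
qed

lemma f_fun_iterate_ge:
  assumes "2 \<le> k"
  shows "(j + 1)\<^sup>2 \<le> (f_fun k ^^ j) k"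
proof (induction j)
  case 0
  then show ?case using assms by simp
next
  case (Suc j)
  let ?y = "(f_fun k ^^ j) k"
  have "(Suc j + 1)\<^sup>2 \<le> 8 * (j + 1)\<^sup>2" by (simp add: power2_eq_square algebra_simps)
  also have "\<dots> \<le> 8 * ?y" using Suc by simp
  also have "\<dots> \<le> 8 * 2 ^ ?y" by (simp add: less_imp_le)
  also have "\<dots> = 2 ^ (?y + 3)" by (simp add: power_add)
  also have "\<dots> \<le> f_fun k ?y" by (rule f_fun_ge[OF assms])
  finally show ?case by simp
qed

text \<open>
  The left-hand side is at most \<open>2 ^ (d\<^sup>2 + 2)\<close>, whereas \<open>D\<close> is essentially a tower of height \<open>d\<close>: its
  last step alone exponentiates a number which is at least \<open>d\<^sup>2\<close>.
\<close>

lemma index_exponent_le: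
  assumes k: "2 \<le> k" and i: "i < d"
  shows "d * (scale_exp d i + 1) \<le> 2 * (f_fun k ^^ d) k"
proof -
  obtain j where d: "d = Suc j" using i by (cases d) auto
  have "d * (scale_exp d i + 1) \<le> (d + 1) * (scale_exp d i + 4)" by (rule mult_le_mono) auto
  also have "\<dots> \<le> (d + 1) * (4 * (d + 1) ^ i)" by (rule mult_le_mono2) (use scale_exp_le i in auto)
  also have "\<dots> = 4 * (d + 1) ^ Suc i" by simp
  also have "\<dots> \<le> 4 * (d + 1) ^ d" using i by (intro mult_le_mono2 power_increasing) auto
  also have "\<dots> \<le> 4 * (2 ^ d) ^ d"
    by (intro mult_le_mono2 power_mono) (simp_all add: Suc_le_eq)
  also have "\<dots> = 2 ^ (d\<^sup>2 + 2)" by (simp add: power_add power2_eq_square flip: power_mult)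
  also have "\<dots> \<le> 2 ^ ((f_fun k ^^ j) k + 3)"
    using f_fun_iterate_ge[OF k, of j] by (intro power_increasing) (auto simp: d)
  also have "\<dots> \<le> (f_fun k ^^ d) k" using f_fun_ge[OF k] by (simp add: d)
  finally show ?thesis by simp
qed

section \<open>Cosets in the Cayley graph and subspaces\<close>

text \<open>
  Translation by \<open>z\<close> maps the coset of \<open>w\<close> onto the coset of \<open>x \<oplus> w\<close>, and this coset is the same for
  all \<open>z\<close> in the coset of \<open>x\<close>. For this reason one value of \<open>t\<close> serves a whole pair of parts.
\<close>

lemma (in abelian_group) card_nbhd_coset:
  assumes H: "additive_subgroup H G" and xw: "x \<in> carrier G" "w \<in> carrier G" and z: "z \<in> H +> x"
  shows "card (nbhd (carrier G) (cayley_edges G A) t z \<inter> (H +> w))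
         = card {u\<in>H +> (x \<oplus> w). (u \<in> A) = (t = 1)}"
proof -
  interpret H: additive_subgroup H G by fact
  have Hc: "h \<in> carrier G" if "h \<in> H" for h using that H.a_subset by auto
  obtain h\<^sub>0 where h0: "h\<^sub>0 \<in> H" "z = h\<^sub>0 \<oplus> x" using z by (auto simp: a_r_coset_def')
  have zG: "z \<in> carrier G" using h0 Hc xw by simp
  have wG: "H +> w \<subseteq> carrier G" using Hc xw by (auto simp: a_r_coset_def')
  have "z \<oplus> w = h\<^sub>0 \<oplus> (x \<oplus> w)" using h0 Hc xw by (simp add: a_assoc)
  then have "z \<oplus> w \<in> H +> (x \<oplus> w)" using h0(1) by (auto simp: a_r_coset_def')
  then have "H +> (x \<oplus> w) = H +> (z \<oplus> w)"
    using a_repr_independence xw H.a_subgroup by simp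
  also have "\<dots> = (\<lambda>y. z \<oplus> y) ` (H +> w)"
  proof -
    have "h \<oplus> (z \<oplus> w) = z \<oplus> (h \<oplus> w)" if "h \<in> H" for h
      using that Hc zG xw by (simp add: a_lcomm)
    then show ?thesis by (auto simp: a_r_coset_def')
  qed
  finally have im: "H +> (x \<oplus> w) = (\<lambda>y. z \<oplus> y) ` (H +> w)" .
  have "{u\<in>H +> (x \<oplus> w). (u \<in> A) = (t = 1)}
      = (\<lambda>y. z \<oplus> y) ` (nbhd (carrier G) (cayley_edges G A) t z \<inter> (H +> w))"
    unfolding im using zG wG by (auto simp: nbhd_def cayley_edges_def)
  moreover have "inj_on (\<lambda>y. z \<oplus> y) (H +> w)"
    using zG wG by (auto simp: inj_on_def subset_iff)
  ultimately show ?thesis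
    by (simp add: card_image inj_on_subset[OF _ Int_lower2])
qed

text \<open>
  Over a prime field scalars are iterated sums of \<open>1\<close>, so subgroups are subspaces.
\<close>

lemma submodule_of_additive_subgroup:
  assumes p: "1 < p" and M: "module (residue_ring (int p)) M" and H: "additive_subgroup H M"
  shows "submodule H (residue_ring (int p)) M"
proof -
  let ?R = "residue_ring (int p)"
  interpret M: module ?R M by fact
  interpret R: residues "int p" ?R
    by unfold_locales (use p in auto)
  interpret H: additive_subgroup H M by fact
  show ?thesis
  proof (intro submodule.intro submodule_axioms.intro H.a_subgroup)
    fix a x assume a: "a \<in> carrier ?R" and x: "x \<in> H"
    then have xM: "x \<in> carrier M" using H.a_subset by auto
    have "int m \<odot>\<^bsub>M\<^esub> x \<in> H" if "m < p" for m
      using that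
    proof (induction m)
      case 0
      then show ?case using M.smult_l_null[OF xM] by (simp add: R.res_zero_eq)
    next
      case (Suc m)
      have "int (Suc m) = int m \<oplus>\<^bsub>?R\<^esub> \<one>\<^bsub>?R\<^esub>"
        using Suc.prems by (simp add: R.res_add_eq R.res_one_eq)
      then have "int (Suc m) \<odot>\<^bsub>M\<^esub> x = int m \<odot>\<^bsub>M\<^esub> x \<oplus>\<^bsub>M\<^esub> x"
        using Suc.prems xM M.smult_l_distr[of "int m" "\<one>\<^bsub>?R\<^esub>" x, OF _ M.R.one_closed]
        by (simp add: R.res_carrier_eq M.smult_one)
      then show ?case using Suc x by simp
    qed
    from this[of "nat a"] a show "a \<odot>\<^bsub>M\<^esub> x \<in> H" by (auto simp: R.res_carrier_eq)
  qed
qed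

text \<open>
  The first term of the maximum already bounds the number of cosets, for every dimension \<open>n\<close>; hence
  the witness \<open>0\<close> for \<open>n\<^sub>3\<close>. The factor \<open>2 d\<close> is at least \<open>1\<close> because every nonempty graph has a tree of
  height \<open>0\<close>, which excludes \<open>d = 0\<close>.
\<close>

theorem corollary4:
  fixes k p d D :: nat and \<epsilon> :: real
  assumes "k \<ge> 2" and "0 < \<epsilon>" and "\<epsilon> < 1" and "prime p"
    and "is_tree_bound_for k d"
    and "D = (f_fun k ^^ d) k"
  shows "\<exists>(n\<^sub>3 :: nat) (C :: real).
    C \<le> max (2 * real d * (4 / \<epsilon>) ^ (2 * D)) (2 * real d * 4 ^ (D\<^sup>2)) \<and>
    (\<forall>n \<ge> n\<^sub>3. \<forall>A \<subseteq> carrier (Fp_space p n). stable_set k (Fp_space p n) A \<longrightarrow>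
      (\<exists>(M :: nat) (V :: nat \<Rightarrow> (nat \<Rightarrow> int) set) H.
        inj_on V {1..M} \<and>
        partition_on (carrier (Fp_space p n)) (V ` {1..M}) \<and>
        real M \<le> C \<and>
        submodule H (residue_ring (int p)) (Fp_space p n) \<and>
        V ` {1..M} = a_rcosets\<^bsub>Fp_space p n\<^esub> H \<and>
        (\<forall>i\<in>{1..M}. \<forall>j\<in>{1..M}. \<exists>t\<in>{0, 1}. \<forall>z\<in>V i.
          real (card (nbhd (carrier (Fp_space p n)) (cayley_edges (Fp_space p n) A) t z \<inter> V j))
            \<ge> (1 - \<epsilon>) * real (card (V j)))))"
proof -
  define C where "C = 2 * real d * (4 / \<epsilon>) ^ (2 * D)"
  have "\<exists>(M :: nat) (V :: nat \<Rightarrow> (nat \<Rightarrow> int) set) H.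
        inj_on V {1..M} \<and>
        partition_on (carrier (Fp_space p n)) (V ` {1..M}) \<and>
        real M \<le> C \<and>
        submodule H (residue_ring (int p)) (Fp_space p n) \<and>
        V ` {1..M} = a_rcosets\<^bsub>Fp_space p n\<^esub> H \<and>
        (\<forall>i\<in>{1..M}. \<forall>j\<in>{1..M}. \<exists>t\<in>{0, 1}. \<forall>z\<in>V i.
          real (card (nbhd (carrier (Fp_space p n)) (cayley_edges (Fp_space p n) A) t z \<inter> V j))
            \<ge> (1 - \<epsilon>) * real (card (V j)))"
    if stable: "stable_set k (Fp_space p n) A" for n A
  proof -
    define G where "G = Fp_space p n"
    have p: "1 < p" by (rule prime_gt_1_nat[OF \<open>prime p\<close>])
    have mod: "module (residue_ring (int p)) G"
      unfolding G_def by (rule module_Fp_space[OF \<open>prime p\<close>])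
    interpret G: abelian_group G by (rule module.axioms(2)[OF mod])
    have fin: "finite (carrier G)"
      by (auto simp: G_def Fp_space_def residue_ring_def intro!: finite_PiE)
    have "tree_bound (carrier G) (cayley_edges G A) \<le> enat d"
      using stable is_graph_cayley[OF G.abelian_group_axioms]
      by (intro tree_bound_le[OF \<open>is_tree_bound_for k d\<close>]) (auto simp: stable_set_def G_def)
    then have no_tree: "\<not> has_tree d (carrier G) (cayley_edges G A)"
      by (simp add: tree_bound_le_iff)
    obtain H i where H: "additive_subgroup H G" and i: "i < d"
      and index: "card (a_rcosets\<^bsub>G\<^esub> H) \<le> (4 / \<epsilon>) ^ (d * (scale_exp d i + 1))"
      and decided: "\<And>K. K \<in> a_rcosets\<^bsub>G\<^esub> H \<Longrightarrow>
        real (card {y\<in>K. y \<in> A}) \<le> \<epsilon> * card K \<or> real (card {y\<in>K. y \<notin> A}) \<le> \<epsilon> * card K"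
      by (rule subgroup_deciding_set[OF G.abelian_group_axioms fin no_tree \<open>0 < \<epsilon>\<close> \<open>\<epsilon> < 1\<close>]) blast
    interpret H: abelian_subgroup H G by (rule abelian_subgroupI3[OF H G.abelian_group_axioms])
    let ?P = "a_rcosets\<^bsub>G\<^esub> H"
    have P: "\<Union>?P = carrier G" by (rule H.a_rcosets_part_G)
    then have "finite ?P" using fin by (metis finite_UnionD)
    then obtain V where V: "bij_betw V {1..card ?P} ?P"
      using ex_bij_betw_nat_finite_1 by blast
    have "real (card ?P) \<le> C"
    proof -
      have "(4 / \<epsilon>) ^ (d * (scale_exp d i + 1)) \<le> (4 / \<epsilon>) ^ (2 * D)"
        using index_exponent_le[OF \<open>k \<ge> 2\<close> i] assms by (intro power_increasing) auto
      also have "\<dots> \<le> 2 * real d * (4 / \<epsilon>) ^ (2 * D)"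
        using i assms(2) by (simp add: mult_le_cancel_right1)
      finally show ?thesis using index by (simp add: C_def)
    qed
    moreover have "partition_on (carrier G) ?P"
    proof (rule partition_onI[OF P])
      show "disjnt K L" if "K \<in> ?P" "L \<in> ?P" "K \<noteq> L" for K L
        using H.a_rcos_disjoint that by (auto simp: pairwise_def)
      show "{} \<notin> ?P" using H.a_rcos_self by (fastforce simp: A_RCOSETS_def')
    qed
    moreover have "submodule H (residue_ring (int p)) G"
      by (rule submodule_of_additive_subgroup[OF p mod H])
    moreover have "\<exists>t\<in>{0, 1}. \<forall>z\<in>K.
        real (card (nbhd (carrier G) (cayley_edges G A) t z \<inter> L)) \<ge> (1 - \<epsilon>) * real (card L)"
      if K: "K \<in> ?P" and L: "L \<in> ?P" for K L
    proof -
      obtain x w where x: "x \<in> carrier G" "K = H +>\<^bsub>G\<^esub> x" and w: "w \<in> carrier G" "L = H +>\<^bsub>G\<^esub> w"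
        using K L by (auto simp: A_RCOSETS_def')
      define J where "J = H +>\<^bsub>G\<^esub> (x \<oplus>\<^bsub>G\<^esub> w)"
      have J: "J \<in> ?P" using x w H.a_subset by (simp add: J_def G.a_rcosetsI)
      have cards: "card J = card L"
        using G.add.card_rcosets_equal[of _ H] J L H.a_subset by (metis A_RCOSETS_def)
      have "finite J" using J P fin by (metis Union_upper finite_subset)
      then have split: "real (card {y\<in>J. y \<in> A}) + real (card {y\<in>J. y \<notin> A}) = real (card J)"
        unfolding of_nat_add[symmetric] by (simp only: card_filter_add_card_filter_not)
      have nb: "card (nbhd (carrier G) (cayley_edges G A) t z \<inter> L) = card {u\<in>J. (u \<in> A) = (t = 1)}"
        if "z \<in> K" for t z
        using G.card_nbhd_coset[OF H x(1) w(1)] that by (simp add: x w J_def)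
      from decided[OF J] show ?thesis
      proof
        assume "real (card {y\<in>J. y \<in> A}) \<le> \<epsilon> * card J"
        with split cards nb[of _ 0] show ?thesis
          by (intro bexI[of _ 0]) (auto simp: algebra_simps)
      next
        assume "real (card {y\<in>J. y \<notin> A}) \<le> \<epsilon> * card J"
        with split cards nb[of _ 1] show ?thesis
          by (intro bexI[of _ 1]) (auto simp: algebra_simps)
      qed
    qed
    ultimately show ?thesis
      unfolding G_def[symmetric] using V
      by (intro exI[of _ "card ?P"] exI[of _ V] exI[of _ H])
         (auto simp: bij_betw_def)
  qed
  then show ?thesis by (intro exI[of _ 0] exI[of _ C]) (auto simp: C_def)
qed

end
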